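(* Let $\rho\in\mathbb{C}$ with $|\rho|<1$, let $x\in(0,\infty)$, and let $a,b,c,d,f>0$ except for possibly pairs of complex conjugates with positive real parts among $a,b,c$ and among $a,d,f$. Then $$ (1-\rho)^{-d+ix}\ {}_2F_1\!\left(\begin{matrix}a+ix,\ b+ix\\ a+b\end{matrix};\rho\right)= \sum_{k=0}^\infty \frac{S_k(x^2;a,d,f)\,\rho^k}{(a+b)_k\,k!}\ {}_2F_1\!\left(\begin{matrix}b-f,\ k+a+d\\ k+a+b\end{matrix};\rho\right). $$
   Context: The Pochhammer symbol is $(z)_n=\prod_{i=1}^n(z+i-1)$ (so $(z)_0=1$). The generalized hypergeometric function is ${}_pF_q(a_1,\dots,a_p;b_1,\dots,b_q;z)=\sum_{n\ge0}\frac{(a_1)_n\cdots(a_p)_n}{(b_1)_n\cdots(b_q)_n}\frac{z^n}{n!}$. Powers of $1-\rho$ are taken with the principal branch. The continuous dual Hahn polynomials are $$S_n(x^2;a,b,c)=(a+b)_n(a+c)_n\ {}_3F_2\!\left(\begin{matrix}-n,\ a+ix,\ a-ix\\ a+b,\ a+c\end{matrix};1\right).$$ The parameter hypothesis means: all parameters have positive real part, and in each of the lists $a,b,c$ and $a,d,f$ the non-real entries (if any) form a complex conjugate pair. (The parameter $c$ enters only through this hypothesis.) *)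

theory Defs
  imports "HOL-Analysis.Analysis"
begin

text \<open>
  The generalized hypergeometric function with upper parameters \<open>as\<close> and lower parameters
  \<open>bs\<close>: the value at \<open>z\<close> of the library's hypergeometric power series. The third argument of
  \<^const>\<open>fps_hypergeo\<close> rescales the variable, hence the \<open>1\<close>.
\<close>
definition hypergeo :: "complex list \<Rightarrow> complex list \<Rightarrow> complex \<Rightarrow> complex" where
  "hypergeo as bs z = eval_fps (fps_hypergeo as bs 1) z"

lemma foldl_mult_eq_prod_list:
  fixes g :: "'b \<Rightarrow> 'a :: comm_monoid_mult"
  shows "foldl (\<lambda>r x. r * g x) c xs = c * (\<Prod>x\<leftarrow>xs. g x)"
  by (induction xs arbitrary: c) (simp_all add: mult.assoc)

lemma hypergeo_altdef:
  "hypergeo as bs z =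
     (\<Sum>n. (\<Prod>a\<leftarrow>as. pochhammer a n) / (\<Prod>b\<leftarrow>bs. pochhammer b n) * z ^ n / fact n)"
  unfolding hypergeo_def eval_fps_def
  by (simp add: foldl_mult_eq_prod_list mult.commute)

text \<open>
  The continuous dual Hahn polynomial \<open>S\<^sub>n(x\<^sup>2; a, b, c)\<close>, with \<open>x\<close> rather than \<open>x\<^sup>2\<close> as the argument.
\<close>
definition cont_dual_hahn :: "nat \<Rightarrow> real \<Rightarrow> complex \<Rightarrow> complex \<Rightarrow> complex \<Rightarrow> complex" where
  "cont_dual_hahn n x a b c =
     pochhammer (a + b) n * pochhammer (a + c) n *
     hypergeo [- of_nat n, a + \<i> * of_real x, a - \<i> * of_real x] [a + b, a + c] 1"

text \<open>
  All parameters are positive except for possibly one pair of complex conjugates with positive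
  real parts.
\<close>
definition positive_or_conjugate_pair :: "complex list \<Rightarrow> bool" where
  "positive_or_conjugate_pair ps \<longleftrightarrow>
     (\<forall>p \<in> set ps. Re p > 0) \<and>
     (let ns = filter (\<lambda>p. p \<notin> \<real>) ps in ns = [] \<or> (\<exists>z. ns = [z, cnj z]))"

end

theory Submission
  imports Defs
begin

text \<open>
  Put \<open>u = a + ix\<close>, \<open>v = a - ix\<close>, \<open>p = a + b\<close>, \<open>q = a + d\<close>, \<open>s = a + f\<close>. As a function of \<open>p\<close> and \<open>q\<close>,
  the continuous dual Hahn polynomial is a finite sum \<open>D\<^sub>n(p, q)\<close>, symmetric in \<open>p\<close> and \<open>q\<close>. The
  Chu--Vandermonde identity yields the connection formula
  \<open>D\<^sub>n(p, q) = \<Sum>k\<le>n. (n choose k) D\<^sub>k(q, s) (p - s)\<^sub>n\<^sub>-\<^sub>k (q + k)\<^sub>n\<^sub>-\<^sub>k\<close>.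
  For \<open>s = u\<close> the polynomial \<open>D\<^sub>k(q, s)\<close> factors, and the formula becomes the generating function
  \<open>\<Sum>n. D\<^sub>n(p, q) \<rho>\<^sup>n / ((p)\<^sub>n n!) = (1 - \<rho>)\<^bsup>u-q\<^esup> \<^sub>2F\<^sub>1(u, p - v; p; \<rho>)\<close>, which is the left-hand side of the
  theorem. Expanding its coefficients by the connection formula for \<open>s = a + f\<close> and exchanging the
  order of summation gives the right-hand side.
\<close>

section \<open>Connection formula\<close>

text \<open>This is \<open>(p)_n (q)_n\<close> times the terminating 3F2 at 1 with upper parameters
  \<open>-n, u, v\<close> and lower parameters \<open>p, q\<close>. Since
  \<open>(p)_n = (p)_i (p + i)_(n-i)\<close>, all denominators cancel and the formula makes sense in
  any commutative ring.\<close>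

definition dual_hahn :: "'a \<Rightarrow> 'a \<Rightarrow> nat \<Rightarrow> 'a \<Rightarrow> 'a \<Rightarrow> 'a :: comm_ring_1" where
  "dual_hahn u v n p q = (\<Sum>i\<le>n. (- 1) ^ i * of_nat (n choose i) * pochhammer u i * pochhammer v i *
     pochhammer (p + of_nat i) (n - i) * pochhammer (q + of_nat i) (n - i))"

lemma dual_hahn_commute: "dual_hahn u v n p q = dual_hahn u v n q p"
  unfolding dual_hahn_def by (intro sum.cong refl) (simp add: mult_ac)

text \<open>Reflection \<open>(-y)_n = (-1)^n (y - n + 1)_n\<close> produces a Pochhammer symbol of
  the sum \<open>v + (1 - c - n)\<close>. The binomial theorem for Pochhammer symbols expands it,
  and reflecting the second factor back gives the alternating signs.\<close>

lemma pochhammer_diff_binomial_sum: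
  fixes c v :: "'a :: comm_ring_1"
  shows "pochhammer (c - v) n =
    (\<Sum>i\<le>n. (- 1) ^ i * of_nat (n choose i) * pochhammer v i * pochhammer (c + of_nat i) (n - i))"
proof -
  have "pochhammer (c - v) n = pochhammer (- (v - c)) n" by simp
  also have "\<dots> = (- 1) ^ n * pochhammer (v + (1 - c - of_nat n)) n"
    by (subst pochhammer_minus) (simp add: algebra_simps)
  also have "\<dots> = (\<Sum>i\<le>n. (- 1) ^ n * (of_nat (n choose i) * pochhammer v i *
      pochhammer (1 - c - of_nat n) (n - i)))"
    by (simp add: pochhammer_binomial_sum sum_distrib_left)
  also have "\<dots> = (\<Sum>i\<le>n. (- 1) ^ i * of_nat (n choose i) * pochhammer v i *
      pochhammer (c + of_nat i) (n - i))"
  proof (intro sum.cong refl)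
    fix i assume "i \<in> {..n}"
    then have i: "i \<le> n" by simp
    have "pochhammer (1 - c - of_nat n) (n - i) = pochhammer (- (c + of_nat n - 1)) (n - i)"
      by (simp add: algebra_simps)
    also have "\<dots> = (- 1) ^ (n - i) * pochhammer (c + of_nat i) (n - i)"
      using i by (subst pochhammer_minus) (simp add: of_nat_diff algebra_simps)
    finally have *: "pochhammer (1 - c - of_nat n) (n - i) =
      (- 1) ^ (n - i) * pochhammer (c + of_nat i) (n - i)" .
    have "(- 1 :: 'a) ^ n * (- 1) ^ (n - i) = (- 1) ^ i * ((- 1) ^ (n - i) * (- 1) ^ (n - i))"
      using i by (metis le_add_diff_inverse mult.assoc power_add)
    also have "\<dots> = (- 1) ^ i" by (simp flip: power_add)
    finally have sgn: "(- 1 :: 'a) ^ n * (- 1) ^ (n - i) = (- 1) ^ i" .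
    have "(- 1) ^ n * (of_nat (n choose i) * pochhammer v i * pochhammer (1 - c - of_nat n) (n - i)) =
      ((- 1) ^ n * (- 1) ^ (n - i)) * of_nat (n choose i) * pochhammer v i *
        pochhammer (c + of_nat i) (n - i)"
      by (simp only: * mult_ac)
    then show "(- 1) ^ n * (of_nat (n choose i) * pochhammer v i *
        pochhammer (1 - c - of_nat n) (n - i)) =
      (- 1) ^ i * of_nat (n choose i) * pochhammer v i * pochhammer (c + of_nat i) (n - i)"
      by (simp only: sgn)
  qed
  finally show ?thesis .
qed

text \<open>For \<open>q = u\<close> the product \<open>(u)_i (u + i)_(n-i) = (u)_n\<close> is free
  of \<open>i\<close> and leaves the sum, which is then the Chu--Vandermonde expansion of
  \<open>(p - v)_n\<close>.\<close>

lemma dual_hahn_factor: "dual_hahn u v n p u = pochhammer u n * pochhammer (p - v) n"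
  unfolding dual_hahn_def pochhammer_diff_binomial_sum sum_distrib_left
proof (intro sum.cong refl)
  fix i assume "i \<in> {..n}"
  then have "pochhammer u n = pochhammer u i * pochhammer (u + of_nat i) (n - i)"
    by (intro pochhammer_product) simp
  then show "(- 1) ^ i * of_nat (n choose i) * pochhammer u i * pochhammer v i *
      pochhammer (p + of_nat i) (n - i) * pochhammer (u + of_nat i) (n - i) =
    pochhammer u n * ((- 1) ^ i * of_nat (n choose i) * pochhammer v i *
      pochhammer (p + of_nat i) (n - i))"
    by (simp add: mult_ac)
qed

lemma dual_hahn_connection:
  fixes u v p q s :: "'a :: comm_ring_1"
  shows "(\<Sum>k\<le>n. of_nat (n choose k) * dual_hahn u v k q s * pochhammer (p - s) (n - k) *
      pochhammer (q + of_nat k) (n - k)) = dual_hahn u v n p q"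
proof -
  \<comment> \<open>\<open>c i\<close> collects the factors free of \<open>k\<close>, so that after
    exchanging the sums only a Vandermonde sum over \<open>k\<close> remains.\<close>
  define c where "c i = (- 1) ^ i * of_nat (n choose i) * pochhammer u i * pochhammer v i *
    pochhammer (q + of_nat i) (n - i)" for i
  define g where "g i k = c i * (of_nat ((n - i) choose (k - i)) *
    pochhammer (s + of_nat i) (k - i) * pochhammer (p - s) (n - k))" for i k
  have "(\<Sum>k\<le>n. of_nat (n choose k) * dual_hahn u v k q s * pochhammer (p - s) (n - k) *
      pochhammer (q + of_nat k) (n - k)) = (\<Sum>k\<le>n. \<Sum>i\<le>k. g i k)"
  proof (intro sum.cong refl)
    fix k assume "k \<in> {..n}"
    then have k: "k \<le> n" by simp
    have summand: "of_nat (n choose k) * ((- 1) ^ i * of_nat (k choose i) * pochhammer u i *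
        pochhammer v i * pochhammer (q + of_nat i) (k - i) * pochhammer (s + of_nat i) (k - i)) *
        pochhammer (p - s) (n - k) * pochhammer (q + of_nat k) (n - k) = g i k"
      if "i \<le> k" for i
    proof -
      have ch: "of_nat (n choose k) * of_nat (k choose i) =
        of_nat (n choose i) * (of_nat ((n - i) choose (k - i)) :: 'a)"
        using choose_mult[OF that k] by (metis of_nat_mult)
      have q: "pochhammer (q + of_nat i) (n - i) =
        pochhammer (q + of_nat i) (k - i) * pochhammer (q + of_nat k) (n - k)"
        using pochhammer_product[of "k - i" "n - i" "q + of_nat i"] that k
        by (simp add: of_nat_diff)
      have "of_nat (n choose k) * ((- 1) ^ i * of_nat (k choose i) * pochhammer u i *
        pochhammer v i * pochhammer (q + of_nat i) (k - i) * pochhammer (s + of_nat i) (k - i)) *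
        pochhammer (p - s) (n - k) * pochhammer (q + of_nat k) (n - k) =
        (of_nat (n choose k) * of_nat (k choose i)) *
        (pochhammer (q + of_nat i) (k - i) * pochhammer (q + of_nat k) (n - k)) *
        ((- 1) ^ i * pochhammer u i * pochhammer v i * pochhammer (s + of_nat i) (k - i) *
        pochhammer (p - s) (n - k))"
        by (simp only: mult_ac)
      also have "\<dots> = g i k"
        unfolding ch q[symmetric] g_def c_def by (simp only: mult_ac)
      finally show ?thesis .
    qed
    show "of_nat (n choose k) * dual_hahn u v k q s * pochhammer (p - s) (n - k) *
      pochhammer (q + of_nat k) (n - k) = (\<Sum>i\<le>k. g i k)"
      unfolding dual_hahn_def sum_distrib_left sum_distrib_right
      by (intro sum.cong refl summand) simp
  qed
  also have "\<dots> = (\<Sum>i\<le>n. \<Sum>k=i..n. g i k)"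
    by (simp add: sum.Sigma, rule sum.reindex_bij_witness[of _ "\<lambda>(i, k). (k, i)" "\<lambda>(k, i). (i, k)"])
      auto
  also have "\<dots> = (\<Sum>i\<le>n. c i * pochhammer (p + of_nat i) (n - i))"
  proof (intro sum.cong refl)
    fix i assume "i \<in> {..n}"
    then have i: "i \<le> n" by simp
    \<comment> \<open>Shifting by \<open>k = m + i\<close> gives the binomial expansion of
      \<open>((s + i) + (p - s))_(n-i)\<close>, in which \<open>s\<close> cancels.\<close>
    have "(\<Sum>k=i..n. g i k) = (\<Sum>m\<le>n - i. g i (m + i))"
      by (rule sum.reindex_bij_witness[of _ "\<lambda>m. m + i" "\<lambda>k. k - i"]) (use i in auto)
    also have "\<dots> = c i * pochhammer ((s + of_nat i) + (p - s)) (n - i)"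
      unfolding pochhammer_binomial_sum[of "s + of_nat i" "p - s"] sum_distrib_left g_def
      by (intro sum.cong refl) (simp add: add.commute)
    finally show "(\<Sum>k=i..n. g i k) = c i * pochhammer (p + of_nat i) (n - i)"
      by (simp add: algebra_simps)
  qed
  also have "\<dots> = dual_hahn u v n p q"
    unfolding c_def dual_hahn_def by (intro sum.cong refl) (simp only: mult_ac)
  finally show ?thesis .
qed

text \<open>Division by \<open>(p)_n n!\<close> splits each summand into a factor depending on
  \<open>k\<close> only and the coefficient of \<open>z^(n-k)\<close> in the 2F1 with parameters
  \<open>p - s, q + k; p + k\<close>. The sum thus becomes an antidiagonal of a double
  series.\<close>

lemma dual_hahn_connection_normalized:
  fixes u v p q s :: "'a :: field_char_0"
  assumes "\<And>n. pochhammer p n \<noteq> 0"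
  shows "(\<Sum>k\<le>n. dual_hahn u v k q s / (pochhammer p k * fact k) *
      (pochhammer (p - s) (n - k) * pochhammer (q + of_nat k) (n - k) /
        (pochhammer (p + of_nat k) (n - k) * fact (n - k)))) =
    dual_hahn u v n p q / (pochhammer p n * fact n)"
proof -
  have "dual_hahn u v k q s / (pochhammer p k * fact k) *
      (pochhammer (p - s) (n - k) * pochhammer (q + of_nat k) (n - k) /
        (pochhammer (p + of_nat k) (n - k) * fact (n - k))) =
    of_nat (n choose k) * dual_hahn u v k q s * pochhammer (p - s) (n - k) *
      pochhammer (q + of_nat k) (n - k) / (pochhammer p n * fact n)" if "k \<le> n" for k
    unfolding pochhammer_product[OF that, of p]
    by (simp add: binomial_fact[OF that] field_simps)
  then show ?thesis
    by (simp add: dual_hahn_connection flip: sum_divide_distrib)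
qed

section \<open>Estimates for the series\<close>

lemma pochhammer_nonzero_Re: "Re p > 0 \<Longrightarrow> pochhammer p n \<noteq> 0"
  by (auto simp: pochhammer_eq_0_iff)

lemma tendsto_shift_ratio:
  fixes a c :: complex
  shows "(\<lambda>n. (a + of_nat n) / (c + of_nat n)) \<longlonglongrightarrow> 1"
proof -
  have "(\<lambda>n. (a - c) / (c + of_nat n)) \<longlonglongrightarrow> 0"
    by (intro tendsto_divide_0[OF tendsto_const] tendsto_add_filterlim_at_infinity[OF tendsto_const]
      tendsto_of_nat)
  then have "(\<lambda>n. 1 + (a - c) / (c + of_nat n)) \<longlonglongrightarrow> 1 + 0"
    by (intro tendsto_intros)
  \<comment> \<open>At \<open>c + n = 0\<close> the quotient is 0 by convention and the rewritten
    form is 1, so they are identified only for large \<open>n\<close>.\<close>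
  moreover have "eventually (\<lambda>n. c + of_nat n \<noteq> 0) sequentially"
  proof -
    obtain N where "norm c < real N" using reals_Archimedean2 by blast
    then have "c + of_nat n \<noteq> 0" if "n \<ge> N" for n
      using that by (metis add_eq_0_iff norm_minus_cancel norm_of_nat not_less of_nat_le_iff
        order_less_le_trans less_irrefl)
    then show ?thesis by (auto simp: eventually_sequentially)
  qed
  then have "eventually (\<lambda>n. 1 + (a - c) / (c + of_nat n) = (a + of_nat n) / (c + of_nat n)) sequentially"
    by eventually_elim (simp add: field_simps)
  ultimately show ?thesis by (simp add: tendsto_cong)
qed

text \<open>Ratio test: the quotient of consecutive terms tends to \<open>z\<close>.\<close>

lemma summable_norm_hypergeo_2_1:
  fixes a b c z :: complex
  assumes z: "norm z < 1"
  shows "summable (\<lambda>n. norm (pochhammer a n * pochhammer b n / (pochhammer c n * fact n) * z ^ n))"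
proof -
  define f where "f n = pochhammer a n * pochhammer b n / (pochhammer c n * fact n) * z ^ n" for n
  define r where "r n = (a + of_nat n) / (c + of_nat n) * ((b + of_nat n) / (1 + of_nat n)) * z" for n
  obtain \<theta> where \<theta>: "norm z < \<theta>" "\<theta> < 1" using z dense by blast
  have "r \<longlonglongrightarrow> 1 * 1 * z" unfolding r_def by (intro tendsto_intros tendsto_shift_ratio)
  then have "(\<lambda>n. norm (r n)) \<longlonglongrightarrow> norm z" using tendsto_norm by fastforce
  from order_tendstoD(2)[OF this \<theta>(1)] obtain N where N: "\<And>n. n \<ge> N \<Longrightarrow> norm (r n) < \<theta>"
    by (auto simp: eventually_sequentially)
  \<comment> \<open>If \<open>c + n = 0\<close>, both sides are 0 because division by zero yields
    0.\<close>
  have step: "f (Suc n) = r n * f n" for n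
    by (simp add: f_def r_def pochhammer_Suc mult_ac)
  have "summable (\<lambda>n. norm (f n))"
  proof (rule summable_ratio_test[OF \<theta>(2)])
    fix n assume "n \<ge> N"
    then show "norm (norm (f (Suc n))) \<le> \<theta> * norm (norm (f n))"
      using N[of n] by (simp add: step norm_mult mult_right_mono)
  qed
  then show ?thesis by (simp add: f_def)
qed

text \<open>Each factor of the quotient is \<open>1 + (q - p) / (p + k + j)\<close>, and the
  denominator has norm at least \<open>Re p + j\<close>. The bound is uniform in \<open>k\<close>,
  so one majorant serves all inner series of the expansion.\<close>

lemma norm_pochhammer_ratio_le:
  fixes p q :: complex
  assumes p: "Re p > 0"
  shows "norm (pochhammer (q + of_nat k) n / pochhammer (p + of_nat k) n)
    \<le> pochhammer (Re p + norm (q - p)) n / pochhammer (Re p) n"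
proof (induction n)
  case (Suc n)
  let ?z = "p + of_nat k + of_nat n"
  have Re: "Re p + n \<le> norm ?z" using complex_Re_le_cmod[of ?z] by simp
  have "norm ((q + of_nat k + of_nat n) / ?z) = norm (1 + (q - p) / ?z)"
  proof -
    have "?z \<noteq> 0" using Re p by auto
    then show ?thesis by (simp add: field_simps)
  qed
  also have "\<dots> \<le> 1 + norm (q - p) / norm ?z"
    by (metis norm_divide norm_one norm_triangle_ineq)
  also have "\<dots> \<le> 1 + norm (q - p) / (Re p + n)"
    using Re p by (intro add_left_mono divide_left_mono mult_pos_pos) auto
  also have "\<dots> = (Re p + norm (q - p) + n) / (Re p + n)"
    using p by (simp add: field_simps)
  finally have "norm ((q + of_nat k + of_nat n) / ?z) \<le> (Re p + norm (q - p) + n) / (Re p + n)" .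
  then have "norm (pochhammer (q + of_nat k) n / pochhammer (p + of_nat k) n) *
      norm ((q + of_nat k + of_nat n) / ?z) \<le>
    pochhammer (Re p + norm (q - p)) n / pochhammer (Re p) n *
      ((Re p + norm (q - p) + n) / (Re p + n))"
    using p by (intro mult_mono Suc.IH divide_nonneg_nonneg pochhammer_nonneg) (auto intro: add_pos_nonneg)
  then show ?case by (simp add: pochhammer_Suc norm_mult norm_divide)
qed simp

text \<open>The product bound makes the double family absolutely summable, so summation by rows and
  by antidiagonals gives the same value.\<close>

lemma sums_rows_of_sums_diagonals:
  fixes g :: "nat \<Rightarrow> nat \<Rightarrow> 'a :: banach"
  assumes \<alpha>: "summable (\<lambda>k. norm (\<alpha> k :: real))" and \<beta>: "summable (\<lambda>m. norm (\<beta> m :: real))"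
    and bound: "\<And>k m. norm (g k m) \<le> norm (\<alpha> k) * norm (\<beta> m)"
    and diag: "(\<lambda>n. \<Sum>k\<le>n. g k (n - k)) sums S"
  shows "(\<lambda>k. \<Sum>m. g k m) sums S"
proof -
  have b: "((\<lambda>m. norm (\<alpha> k) * norm (\<beta> m)) has_sum (norm (\<alpha> k) * (\<Sum>m. norm (\<beta> m)))) UNIV" for k
    by (intro has_sum_cmult_right norm_summable_imp_has_sum summable_sums) (use \<beta> in auto)
  have "(\<lambda>(k, m). norm (\<alpha> k) * norm (\<beta> m)) summable_on (UNIV \<times> UNIV)"
  proof (rule summable_on_SigmaI)
    show "(\<lambda>k. norm (\<alpha> k) * (\<Sum>m. norm (\<beta> m))) summable_on UNIV"
      by (intro summable_on_cmult_left norm_summable_imp_summable_on) (use \<alpha> in auto)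
  qed (use b in auto)
  then have "(\<lambda>x. norm ((\<lambda>(k, m). g k m) x)) summable_on (UNIV \<times> UNIV)"
    by (rule Infinite_Sum.abs_summable_on_comparison_test') (use bound in auto)
  then have "(\<lambda>(k, m). g k m) summable_on (UNIV \<times> UNIV)"
    by (rule abs_summable_summable)
  then obtain T where T: "((\<lambda>(k, m). g k m) has_sum T) (UNIV \<times> UNIV)"
    by (auto simp: summable_on_def)
  have row: "((\<lambda>m. g k m) has_sum (\<Sum>m. g k m)) UNIV" for k
  proof -
    have "summable (\<lambda>m. norm (g k m))"
      by (rule summable_comparison_test'[OF summable_mult[OF \<beta>, of "norm (\<alpha> k)"], of 0])
        (use bound in auto)
    then show ?thesis
      by (intro norm_summable_imp_has_sum summable_sums) (auto dest: summable_norm_cancel)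
  qed
  have "((\<lambda>k. \<Sum>m. g k m) has_sum T) UNIV"
    by (rule has_sum_SigmaD[OF T]) (use row in simp)
  then have rows: "(\<lambda>k. \<Sum>m. g k m) sums T" by (rule has_sum_imp_sums)
  \<comment> \<open>The map sends the \<open>n\<close>-th row of the triangle to the antidiagonal
    \<open>k + m = n\<close>.\<close>
  have bij: "bij_betw (\<lambda>(n, k). (k, n - k)) (Sigma UNIV (\<lambda>n :: nat. {..n})) (UNIV \<times> UNIV)"
    by (rule bij_betwI[where g = "\<lambda>(k, m). (k + m, k)"]) auto
  have "((\<lambda>x. (\<lambda>(k, m). g k m) ((\<lambda>(n, k). (k, n - k)) x)) has_sum T) (Sigma UNIV (\<lambda>n. {..n}))"
    using T by (subst has_sum_reindex_bij_betw[OF bij])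
  then have "((\<lambda>n. \<Sum>k\<le>n. g k (n - k)) has_sum T) UNIV"
    by (rule has_sum_SigmaD) (auto intro!: has_sum_finiteI)
  then have "(\<lambda>n. \<Sum>k\<le>n. g k (n - k)) sums T" by (rule has_sum_imp_sums)
  with diag rows show ?thesis using sums_unique2 by blast
qed

section \<open>Generating function and expansion\<close>

lemma sums_powr_one_minus:
  fixes z a :: complex
  assumes "norm z < 1"
  shows "(\<lambda>n. pochhammer a n / fact n * z ^ n) sums ((1 - z) powr (- a))"
proof -
  have "(- a gchoose n) * (- z) ^ n = pochhammer a n / fact n * z ^ n" for n
  proof -
    have "(- a gchoose n) * (- z) ^ n = pochhammer a n / fact n * ((- 1) ^ n * (- z) ^ n)"
      by (simp add: gbinomial_pochhammer)
    also have "(- 1) ^ n * (- z) ^ n = z ^ n"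
      by (simp flip: power_mult_distrib)
    finally show ?thesis .
  qed
  then show ?thesis
    using gen_binomial_complex[of "- z" "- a"] assms by simp
qed

context
  fixes u v p q :: complex
  assumes p: "Re p > 0"
begin

text \<open>This is the connection formula with \<open>s = u\<close> and with \<open>p\<close> and
  \<open>q\<close> interchanged. The inner polynomial factors by \<open>dual_hahn_factor\<close>,
  and \<open>(p + k)_(n-k) / (p)_n = 1 / (p)_k\<close> separates the terms into a Cauchy
  product.\<close>

lemma dual_hahn_series_Cauchy:
  "dual_hahn u v n p q / (pochhammer p n * fact n) * z ^ n =
    (\<Sum>k\<le>n. (pochhammer u k * pochhammer (p - v) k / (pochhammer p k * fact k) * z ^ k) *
      (pochhammer (q - u) (n - k) / fact (n - k) * z ^ (n - k)))"
proof -
  have "dual_hahn u v n p q = dual_hahn u v n q p" by (rule dual_hahn_commute)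
  also have "\<dots> / (pochhammer p n * fact n) * z ^ n = (\<Sum>k\<le>n.
      (of_nat (n choose k) * dual_hahn u v k p u * pochhammer (q - u) (n - k) *
      pochhammer (p + of_nat k) (n - k)) / (pochhammer p n * fact n) * z ^ n)"
    by (simp add: sum_distrib_right sum_divide_distrib flip: dual_hahn_connection[of n u v p u q])
  also have "\<dots> = (\<Sum>k\<le>n. (pochhammer u k * pochhammer (p - v) k / (pochhammer p k * fact k) * z ^ k) *
      (pochhammer (q - u) (n - k) / fact (n - k) * z ^ (n - k)))"
  proof (intro sum.cong refl)
    fix k assume "k \<in> {..n}"
    then have k: "k \<le> n" by simp
    have nz: "pochhammer p k \<noteq> 0" "pochhammer (p + of_nat k) (n - k) \<noteq> 0"
      using p by (auto intro!: pochhammer_nonzero_Re add_pos_nonneg)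
    have z: "z ^ n = z ^ k * z ^ (n - k)" using k by (simp flip: power_add)
    show "of_nat (n choose k) * dual_hahn u v k p u * pochhammer (q - u) (n - k) *
      pochhammer (p + of_nat k) (n - k) / (pochhammer p n * fact n) * z ^ n =
      (pochhammer u k * pochhammer (p - v) k / (pochhammer p k * fact k) * z ^ k) *
      (pochhammer (q - u) (n - k) / fact (n - k) * z ^ (n - k))"
      unfolding pochhammer_product[OF k, of p] z dual_hahn_factor
      using nz by (simp add: binomial_fact[OF k] field_simps)
  qed
  finally show ?thesis .
qed

lemma dual_hahn_generating_function:
  assumes "norm z < 1"
  shows "(\<lambda>n. dual_hahn u v n p q / (pochhammer p n * fact n) * z ^ n) sums
    ((1 - z) powr (u - q) * hypergeo [u, p - v] [p] z)"
proof -
  have s1: "summable (\<lambda>n. norm (pochhammer u n * pochhammer (p - v) n / (pochhammer p n * fact n) * z ^ n))"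
    by (rule summable_norm_hypergeo_2_1[OF assms])
  have s2: "summable (\<lambda>n. norm (pochhammer (q - u) n / fact n * z ^ n))"
    \<comment> \<open>The binomial series is a 2F1 whose second upper and lower parameters are both
      1.\<close>
    using summable_norm_hypergeo_2_1[OF assms, of "q - u" 1 1] by (simp flip: pochhammer_fact)
  have e: "(1 - z) powr (u - q) = (\<Sum>n. pochhammer (q - u) n / fact n * z ^ n)"
    using sums_unique[OF sums_powr_one_minus[OF assms, of "q - u"]] by simp
  show ?thesis
    unfolding dual_hahn_series_Cauchy e hypergeo_altdef
    using Cauchy_product_sums[OF s1 s2] by (simp add: mult.commute)
qed

end

text \<open>With \<open>(s)_k\<close> in place of \<open>(p)_k\<close> the series is a convergent
  generating function at a radius \<open>r > |z|\<close>, so its terms there are bounded. Replacing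
  \<open>(s)_k\<close> by \<open>(p)_k\<close> costs at most the factor \<open>B k\<close>, which
  the geometric factor \<open>(|z| / r)^k\<close> absorbs.\<close>

lemma summable_norm_dual_hahn:
  fixes u v p q s z :: complex
  assumes p: "Re p > 0" and s: "Re s > 0" and z: "norm z < 1"
  shows "summable (\<lambda>k. norm (dual_hahn u v k q s / (pochhammer p k * fact k) * z ^ k))"
proof -
  obtain r where r: "norm z < r" "r < 1" using z dense by blast
  have r0: "r > 0" using r(1) norm_ge_zero[of z] by linarith
  define A where "A k = dual_hahn u v k q s / (pochhammer s k * fact k)" for k
  define B where "B k = pochhammer (Re p + norm (s - p)) k / pochhammer (Re p) k" for k
  \<comment> \<open>By symmetry \<open>A k\<close> is a coefficient of the generating function with
    first parameter \<open>s\<close>.\<close>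
  have "summable (\<lambda>k. A k * of_real r ^ k)"
    using dual_hahn_generating_function[OF s, of "of_real r" u v q] r r0
    by (auto simp: A_def dual_hahn_commute[of u v _ s] dest: sums_summable)
  from summable_imp_Bseq[OF this] obtain C where C: "\<And>k. norm (A k * of_real r ^ k) \<le> C"
    by (auto simp: Bseq_def)
  have "summable (\<lambda>k. norm (of_real (B k) * of_real (norm z / r) ^ k :: complex))"
    using summable_norm_hypergeo_2_1[of "of_real (norm z / r)" "of_real (Re p + norm (s - p))" 1 "of_real (Re p)"] r r0
    by (simp add: B_def norm_divide pochhammer_of_real del: of_real_add flip: pochhammer_fact)
  then have sB: "summable (\<lambda>k. C * norm (B k * (norm z / r) ^ k))"
    by (intro summable_mult) (simp add: norm_divide norm_mult norm_power abs_mult power_abs)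
  show ?thesis
  proof (rule summable_comparison_test'[OF sB, of 0])
    fix k
    have nz: "pochhammer s k \<noteq> 0" "pochhammer p k \<noteq> 0"
      by (rule pochhammer_nonzero_Re, fact)+
    have "dual_hahn u v k q s / (pochhammer p k * fact k) * z ^ k =
      (A k * of_real r ^ k) * (pochhammer s k / pochhammer p k) * (z / of_real r) ^ k"
      using nz r0 by (simp add: A_def power_divide)
    also have "norm \<dots> \<le> C * B k * norm ((z / of_real r) ^ k)"
      unfolding norm_mult[of _ "(z / of_real r) ^ k"] norm_mult[of _ "pochhammer s k / pochhammer p k"]
      using norm_pochhammer_ratio_le[OF p, of s 0 k] C[of k] order_trans[OF norm_ge_zero C[of k]]
      by (intro mult_right_mono mult_mono) (auto simp: B_def)
    also have "\<dots> \<le> C * norm (B k * (norm z / r) ^ k)"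
      using order_trans[OF norm_ge_zero C[of k]] r0
      by (simp add: norm_power norm_divide abs_mult mult.assoc mult_left_mono mult_right_mono)
    finally show "norm (norm (dual_hahn u v k q s / (pochhammer p k * fact k) * z ^ k)) \<le>
      C * norm (B k * (norm z / r) ^ k)" by simp
  qed
qed

text \<open>In the double series of terms \<open>A k * B k m\<close>, the connection formula
  collapses the antidiagonals to the generating function, while the rows are the hypergeometric
  functions in the claim.\<close>

lemma dual_hahn_expansion:
  fixes u v p q s z :: complex
  assumes p: "Re p > 0" and s: "Re s > 0" and z: "norm z < 1"
  shows "(\<lambda>k. dual_hahn u v k q s * z ^ k / (pochhammer p k * fact k) *
      hypergeo [p - s, q + of_nat k] [p + of_nat k] z) sums
    ((1 - z) powr (u - q) * hypergeo [u, p - v] [p] z)"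
proof -
  define A where "A k = dual_hahn u v k q s / (pochhammer p k * fact k) * z ^ k" for k
  define B where "B k m = pochhammer (p - s) m * pochhammer (q + of_nat k) m /
    (pochhammer (p + of_nat k) m * fact m) * z ^ m" for k m
  \<comment> \<open>\<open>\<beta> m\<close> bounds the norm of \<open>B k m\<close> for every
    \<open>k\<close>; it comes from \<open>norm_pochhammer_ratio_le\<close>.\<close>
  define \<beta> where "\<beta> m = norm (pochhammer (p - s) m) *
    (pochhammer (Re p + norm (q - p)) m / pochhammer (Re p) m) / fact m * norm z ^ m" for m
  have \<beta>0: "\<beta> m \<ge> 0" for m
    unfolding \<beta>_def using p
    by (intro mult_nonneg_nonneg divide_nonneg_nonneg pochhammer_nonneg) (auto intro: add_pos_nonneg)
  \<comment> \<open>Written as norms of 2F1 terms with real second and lower parameters, the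
    majorant falls under the ratio test above.\<close>
  have \<beta>_eq: "\<beta> = (\<lambda>m. norm (pochhammer (p - s) m * pochhammer (of_real (Re p + norm (q - p))) m /
      (pochhammer (of_real (Re p)) m * fact m) * z ^ m))"
  proof
    fix m
    have "pochhammer (Re p + norm (q - p)) m \<ge> 0" "pochhammer (Re p) m \<ge> 0"
      using p by (auto intro!: pochhammer_nonneg add_pos_nonneg)
    then show "\<beta> m = norm (pochhammer (p - s) m * pochhammer (of_real (Re p + norm (q - p))) m /
      (pochhammer (of_real (Re p)) m * fact m) * z ^ m)"
      by (simp add: \<beta>_def norm_mult norm_divide norm_power pochhammer_of_real del: of_real_add)
  qed
  have s\<beta>: "summable \<beta>"
    unfolding \<beta>_eq by (rule summable_norm_hypergeo_2_1[OF z])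
  have bound: "norm (A k * B k m) \<le> norm (norm (A k)) * norm (\<beta> m)" for k m
  proof -
    have "norm (B k m) = norm (pochhammer (p - s) m) *
      norm (pochhammer (q + of_nat k) m / pochhammer (p + of_nat k) m) / fact m * norm z ^ m"
      by (simp add: B_def norm_mult norm_divide norm_power)
    also have "\<dots> \<le> \<beta> m"
      unfolding \<beta>_def
      by (intro mult_right_mono divide_right_mono mult_left_mono norm_pochhammer_ratio_le[OF p]) auto
    finally show ?thesis using \<beta>0[of m] by (simp add: norm_mult mult_left_mono)
  qed
  have diag: "(\<Sum>k\<le>n. A k * B k (n - k)) = dual_hahn u v n p q / (pochhammer p n * fact n) * z ^ n" for n
  proof -
    have zn: "z ^ n = z ^ k * z ^ (n - k)" if "k \<le> n" for k
      using that by (simp flip: power_add)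
    have "dual_hahn u v n p q / (pochhammer p n * fact n) * z ^ n = (\<Sum>k\<le>n.
      dual_hahn u v k q s / (pochhammer p k * fact k) *
      (pochhammer (p - s) (n - k) * pochhammer (q + of_nat k) (n - k) /
        (pochhammer (p + of_nat k) (n - k) * fact (n - k))) * z ^ n)"
      by (simp only: dual_hahn_connection_normalized[OF pochhammer_nonzero_Re[OF p]]
        flip: sum_distrib_right)
    also have "\<dots> = (\<Sum>k\<le>n. A k * B k (n - k))"
    proof (intro sum.cong refl)
      fix k assume "k \<in> {..n}"
      then have "z ^ n = z ^ k * z ^ (n - k)" using zn by simp
      then show "dual_hahn u v k q s / (pochhammer p k * fact k) *
        (pochhammer (p - s) (n - k) * pochhammer (q + of_nat k) (n - k) /
        (pochhammer (p + of_nat k) (n - k) * fact (n - k))) * z ^ n = A k * B k (n - k)"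
        unfolding A_def B_def by (simp only: mult_ac)
    qed
    finally show ?thesis by simp
  qed
  have "(\<lambda>k. \<Sum>m. A k * B k m) sums ((1 - z) powr (u - q) * hypergeo [u, p - v] [p] z)"
  proof (rule sums_rows_of_sums_diagonals[OF _ _ bound])
    show "summable (\<lambda>k. norm (norm (A k)))"
      unfolding A_def using summable_norm_dual_hahn[OF p s z] by simp
    show "summable (\<lambda>m. norm (\<beta> m))" using s\<beta> \<beta>0 by simp
    show "(\<lambda>n. \<Sum>k\<le>n. A k * B k (n - k)) sums ((1 - z) powr (u - q) * hypergeo [u, p - v] [p] z)"
      unfolding diag by (rule dual_hahn_generating_function[OF p z])
  qed
  moreover have "(\<Sum>m. A k * B k m) = dual_hahn u v k q s * z ^ k / (pochhammer p k * fact k) *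
      hypergeo [p - s, q + of_nat k] [p + of_nat k] z" for k
  proof -
    have "summable (B k)"
      unfolding B_def by (rule summable_norm_cancel[OF summable_norm_hypergeo_2_1[OF z]])
    then have "(\<Sum>m. A k * B k m) = A k * (\<Sum>m. B k m)" by (rule suminf_mult)
    then show ?thesis by (simp add: A_def B_def hypergeo_altdef)
  qed
  ultimately show ?thesis by simp
qed

text \<open>Termwise, \<open>(-n)_i / i!\<close> is a signed binomial coefficient, and the
  prefactors cancel the denominators, which are nonzero by the conditions on the real parts.\<close>

lemma cont_dual_hahn_eq_dual_hahn:
  assumes "Re (a + b) > 0" "Re (a + c) > 0"
  shows "cont_dual_hahn n x a b c = dual_hahn (a + \<i> * x) (a - \<i> * x) n (a + b) (a + c)"
proof -
  define t where "t i = pochhammer (- of_nat n) i * (pochhammer (a + \<i> * x) i * pochhammer (a - \<i> * x) i) /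
    (pochhammer (a + b) i * pochhammer (a + c) i) / fact i" for i
  have "hypergeo [- of_nat n, a + \<i> * of_real x, a - \<i> * of_real x] [a + b, a + c] 1 = (\<Sum>i. t i)"
    by (simp add: hypergeo_altdef t_def)
  \<comment> \<open>The series terminates because \<open>(-n)_i = 0\<close> for
    \<open>i > n\<close>.\<close>
  also have "\<dots> = (\<Sum>i\<le>n. t i)"
    by (rule suminf_finite) (auto simp: t_def pochhammer_of_nat_eq_0_lemma)
  finally have "cont_dual_hahn n x a b c = (\<Sum>i\<le>n. pochhammer (a + b) n * pochhammer (a + c) n * t i)"
    by (simp add: cont_dual_hahn_def sum_distrib_left)
  also have "\<dots> = dual_hahn (a + \<i> * x) (a - \<i> * x) n (a + b) (a + c)"
    unfolding dual_hahn_def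
  proof (intro sum.cong refl)
    fix i assume "i \<in> {..n}"
    then have i: "i \<le> n" by simp
    have nz: "pochhammer (a + b) i \<noteq> 0" "pochhammer (a + c) i \<noteq> 0"
      using assms by (auto intro!: pochhammer_nonzero_Re)
    have ch: "pochhammer (- of_nat n) i = (- 1) ^ i * of_nat (n choose i) * (fact i :: complex)"
      by (simp add: binomial_gbinomial gbinomial_pochhammer flip: power_mult_distrib mult.assoc)
    show "pochhammer (a + b) n * pochhammer (a + c) n * t i =
      (- 1) ^ i * of_nat (n choose i) * pochhammer (a + \<i> * x) i * pochhammer (a - \<i> * x) i *
      pochhammer (a + b + of_nat i) (n - i) * pochhammer (a + c + of_nat i) (n - i)"
      unfolding t_def ch pochhammer_product[OF i, of "a + b"] pochhammer_product[OF i, of "a + c"]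
      using nz by (simp add: field_simps)
  qed
  finally show ?thesis .
qed

theorem theorem3p4:
  fixes \<rho> a b c d f :: complex and x :: real
  assumes "norm \<rho> < 1"
    and "x > 0"
    and "positive_or_conjugate_pair [a, b, c]"
    and "positive_or_conjugate_pair [a, d, f]"
  shows "(\<lambda>k. cont_dual_hahn k x a d f * \<rho> ^ k / (pochhammer (a + b) k * fact k) *
              hypergeo [b - f, of_nat k + a + d] [of_nat k + a + b] \<rho>)
         sums ((1 - \<rho>) powr (- d + \<i> * of_real x) *
               hypergeo [a + \<i> * of_real x, b + \<i> * of_real x] [a + b] \<rho>)"
proof -
  have "Re a > 0" "Re b > 0" "Re d > 0" "Re f > 0"
    using assms(3,4) by (auto simp: positive_or_conjugate_pair_def)
  then have Re: "Re (a + b) > 0" "Re (a + d) > 0" "Re (a + f) > 0" by auto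
  \<comment> \<open>With \<open>p = a + b\<close>, \<open>q = a + d\<close>,
    \<open>s = a + f\<close>, one has \<open>u - q = -d + ix\<close>, \<open>p - v = b + ix\<close>
    and \<open>p - s = b - f\<close>.\<close>
  show ?thesis
    using dual_hahn_expansion[OF Re(1,3) assms(1), of "a + \<i> * x" "a - \<i> * x" "a + d"]
    by (simp add: cont_dual_hahn_eq_dual_hahn[OF Re(2,3)] algebra_simps)
qed

end
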